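(* Let $\Pi$ be a Gibbs partition with parameters $(\alpha,V)$, let $n,m\ge1$, and condition on the restriction of $\Pi$ to $[n]$ being a given partition into $j$ blocks with sizes $(n_1,\dots,n_j)$. For $l\in\{1,\dots,m\}$ let $W^{(n)}_{l,m}$ be the (conditional) number of new blocks of size $l$ generated by the integers $n+1,\dots,n+m$. Then (probabilities and expectations being conditional on the given partition of $[n]$) for $x=0,\dots,\lfloor m/l\rfloor$, $$\mathbb{P}(W^{(n)}_{l,m}=x)=\frac{[(1-\alpha)_{l-1}]^x}{x!\,(l!)^x}\frac{m!}{V_{n,j}}\sum_{r=0}^{\lfloor m/l\rfloor-x}\frac{(-1)^r[(1-\alpha)_{l-1}]^r}{r!\,(l!)^r(m-rl-xl)!}\sum_{k-r-x=0}^{m-rl-xl}V_{n+m,j+k}\,S^{-1,-\alpha,-(n-j\alpha)}_{m-rl-xl,\;k-r-x},$$ and $$\mathbb{E}(W^{(n)}_{l,m})=\binom ml\frac{(1-\alpha)_{l-1}}{V_{n,j}}\sum_{k-1=0}^{m-l}V_{n+m,j+k}\,S^{-1,-\alpha,-(n-j\alpha)}_{m-l,k-1},$$ the latter being the Bayesian nonparametric estimator under quadratic loss of the number of new species represented $l$ times. In particular, for the number of new singletons, for $x=0,\dots,m$, $$\mathbb{P}(W^{(n)}_{1,m}=x)=\frac{m!}{x!}\frac1{V_{n,j}}\sum_{r=0}^{m-x}\frac{(-1)^r}{r!\,(m-r-x)!}\sum_{k-r-x=0}^{m-r-x}V_{n+m,j+k}\,S^{-1,-\alpha,-(n-j\alpha)}_{m-r-x,\,k-r-x},$$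 $$\mathbb{E}(W^{(n)}_{1,m})=\frac m{V_{n,j}}\sum_{k-1=0}^{m-1}V_{n+m,j+k}\,S^{-1,-\alpha,-(n-j\alpha)}_{m-1,k-1}.$$
   Context: Notation: $(x)_n=x(x+1)\cdots(x+n-1)$ ($(x)_0=1$); $\sum_{k-a=0}^{M}$ means $k$ ranges over $a,\dots,a+M$. The Bayesian estimator under quadratic loss is the conditional expectation given the observed partition of $[n]$ (blocks are "species"). Gibbs partition with parameters $(\alpha,V)$: $\alpha\in(-\infty,1)$ and $V=(V_{n,k})_{1\le k\le n}$ are nonnegative weights with $V_{1,1}=1$ and $V_{n,k}=(n-k\alpha)V_{n+1,k}+V_{n+1,k+1}$; $\Pi$ is the exchangeable random partition of the positive integers such that for every $n$ and every partition $\{A_1,\dots,A_k\}$ of $[n]=\{1,\dots,n\}$, the restriction $\Pi_n$ of $\Pi$ to $[n]$ satisfies $\mathbb{P}(\Pi_n=\{A_1,\dots,A_k\})=V_{n,k}\prod_{i=1}^k(1-\alpha)_{|A_i|-1}$. Conditional setting: it is assumed $V_{n,j}>0$. Given $\Pi_n$ (with $j$ blocks of sizes $n_1,\dots,n_j$), a block of $\Pi_{n+m}$ is old if it meets $[n]$, new otherwise. The conditional probability that $\Pi_{n+m}$ equals a specified partition extending $\Pi_n$, in which the old blocks gain $m_1,\dots,m_j\ge0$ elements and there are $k$ new blocks of sizes $s_1,\dots,s_k\ge1$, is $\frac{V_{n+m,j+k}}{V_{n,j}}\prod_{i=1}^j(n_i-\alpha)_{m_i}\prod_{i=1}^k(1-\alpha)_{s_i-1}$.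 Generalized central Stirling numbers: $S^{-1,-\alpha}_{n,k}=\frac{n!}{k!}\sum_{(n_1,\dots,n_k)}\prod_{j=1}^k\frac{(1-\alpha)_{n_j-1}}{n_j!}$, the sum being over compositions of $n$ into $k$ positive parts ($S_{0,0}^{-1,-\alpha}=1$, $S_{n,0}^{-1,-\alpha}=0$ for $n\ge1$, $S_{n,k}^{-1,-\alpha}=0$ for $k>n$). Generalized non-central Stirling numbers: $S^{-1,-\alpha,\gamma}_{n,k}=\sum_{s=k}^n\binom ns S^{-1,-\alpha}_{s,k}(-\gamma)_{n-s}$. *)

theory Defs
  imports "HOL-Probability.Probability" "HOL-Combinatorics.Permutations"
begin

definition restr_part :: "nat \<Rightarrow> nat set set \<Rightarrow> nat set set" where
  "restr_part n P = (\<lambda>B. B \<inter> {1..n}) ` P - {{}}"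

locale exchangeable_random_partition = prob_space M
  for M :: "'w measure" +
  fixes \<pi> :: "'w \<Rightarrow> nat set set"
  assumes partition_\<pi>: "\<And>\<omega>. \<omega> \<in> space M \<Longrightarrow> partition_on {1..} (\<pi> \<omega>)"
    and measurable_restr: "\<And>n. (\<lambda>\<omega>. restr_part n (\<pi> \<omega>)) \<in> M \<rightarrow>\<^sub>M count_space UNIV"
    and exchangeable: "\<And>n p A. p permutes {1..n} \<Longrightarrow> partition_on {1..n} A \<Longrightarrow>
      \<P>(\<omega> in M. restr_part n (\<pi> \<omega>) = (\<lambda>B. p ` B) ` A) = \<P>(\<omega> in M. restr_part n (\<pi> \<omega>) = A)"

definition gibbs_weights :: "real \<Rightarrow> (nat \<Rightarrow> nat \<Rightarrow> real) \<Rightarrow> bool" where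
  "gibbs_weights \<alpha> V \<longleftrightarrow>
     (\<forall>n k. 1 \<le> k \<and> k \<le> n \<longrightarrow> V n k \<ge> 0) \<and>
     V 1 1 = 1 \<and>
     (\<forall>n k. 1 \<le> k \<and> k \<le> n \<longrightarrow>
        V n k = (real n - real k * \<alpha>) * V (n + 1) k + V (n + 1) (k + 1))"

locale gibbs_partition = exchangeable_random_partition M \<pi>
  for M :: "'w measure" and \<pi> :: "'w \<Rightarrow> nat set set" +
  fixes \<alpha> :: real and V :: "nat \<Rightarrow> nat \<Rightarrow> real"
  assumes alpha_less_1: "\<alpha> < 1"
    and weights: "gibbs_weights \<alpha> V"
    and law: "\<And>n A. 1 \<le> n \<Longrightarrow> partition_on {1..n} A \<Longrightarrow>
      \<P>(\<omega> in M. restr_part n (\<pi> \<omega>) = A) =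
        V n (card A) * (\<Prod>B\<in>A. pochhammer (1 - \<alpha>) (card B - 1))"

definition num_new_blocks :: "nat \<Rightarrow> nat \<Rightarrow> nat \<Rightarrow> nat set set \<Rightarrow> nat" where
  "num_new_blocks n m l P = card {B \<in> restr_part (n + m) P. B \<inter> {1..n} = {} \<and> card B = l}"

text \<open>The Bayesian estimator of \<open>X\<close> under quadratic loss: its conditional expectation given
  the sigma-algebra generated by the observed partition of \<open>{1..n}\<close>.\<close>

definition bayes_estimator ::
  "'w measure \<Rightarrow> ('w \<Rightarrow> nat set set) \<Rightarrow> nat \<Rightarrow> ('w \<Rightarrow> real) \<Rightarrow> 'w \<Rightarrow> real" where
  "bayes_estimator M \<pi> n X =
     real_cond_exp M (vimage_algebra (space M) (\<lambda>\<omega>. restr_part n (\<pi> \<omega>)) (count_space UNIV)) X"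

definition compositions :: "nat \<Rightarrow> nat \<Rightarrow> nat list set" where
  "compositions n k = {ns. length ns = k \<and> sum_list ns = n \<and> (\<forall>i\<in>set ns. 1 \<le> i)}"

text \<open>\<open>central_stirling \<alpha> n k\<close> is $S^{-1,-\alpha}_{n,k}$ and \<open>noncentral_stirling \<alpha> \<gamma> n k\<close> is
  $S^{-1,-\alpha,\gamma}_{n,k}$. The boundary conventions (value 1 at \<open>n = k = 0\<close>; value 0 for
  \<open>n \<ge> 1, k = 0\<close> and for \<open>k > n\<close>) come out of the set of compositions.\<close>

definition central_stirling :: "real \<Rightarrow> nat \<Rightarrow> nat \<Rightarrow> real" where
  "central_stirling \<alpha> n k = fact n / fact k *
     (\<Sum>ns\<in>compositions n k. \<Prod>i<k. pochhammer (1 - \<alpha>) (ns ! i - 1) / fact (ns ! i))"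

definition noncentral_stirling :: "real \<Rightarrow> real \<Rightarrow> nat \<Rightarrow> nat \<Rightarrow> real" where
  "noncentral_stirling \<alpha> \<gamma> n k =
     (\<Sum>s=k..n. real (n choose s) * central_stirling \<alpha> s k * pochhammer (- \<gamma>) (n - s))"

lemma finite_compositions: "finite (compositions n k)"
proof (rule finite_subset)
  show "compositions n k \<subseteq> {ns. set ns \<subseteq> {..n} \<and> length ns = k}"
    using member_le_sum_list by (fastforce simp: compositions_def)
  show "finite {ns. set ns \<subseteq> {..n} \<and> length ns = k}"
    by (rule finite_lists_length_eq) simp
qed

lemma central_stirling_0_0: "central_stirling \<alpha> 0 0 = 1"
proof -
  have "compositions 0 0 = {[]}" by (auto simp: compositions_def)
  then show ?thesis by (simp add: central_stirling_def)
qed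

lemma central_stirling_Suc_0: "n \<ge> 1 \<Longrightarrow> central_stirling \<alpha> n 0 = 0"
proof -
  assume "n \<ge> 1"
  then have "compositions n 0 = {}" by (auto simp: compositions_def)
  then show ?thesis by (simp add: central_stirling_def)
qed

lemma central_stirling_gt: "k > n \<Longrightarrow> central_stirling \<alpha> n k = 0"
proof -
  assume *: "k > n"
  have "length ns \<le> sum_list ns" if "\<forall>i\<in>set ns. 1 \<le> i" for ns :: "nat list"
    using that by (induction ns) auto
  with * have "compositions n k = {}" by (fastforce simp: compositions_def)
  then show ?thesis by (simp add: central_stirling_def)
qed

end

theory Submission
  imports Defs "HOL-Computational_Algebra.Formal_Power_Series"
begin

text \<open>The binomial moments of the number of new blocks of a given size satisfy a recursion in their
  order: marking one of the new blocks of a partition of \<open>{1..n + m}\<close> and deleting it leaves a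
  partition of a smaller ground set that still extends the given partition of \<open>{1..n}\<close>. The same
  marking of an arbitrary new block gives, for the total weight of the extensions with \<open>k\<close> new
  blocks, the recursion in \<open>k\<close> that the exponential generating function of the non-central Stirling
  numbers gives for them; the case \<open>k = 0\<close> follows by inserting the integers one by one into the
  old blocks, each insertion multiplying the weight by \<open>n - j\<alpha>\<close> plus the number of integers
  inserted before. The distribution follows from the binomial moments by inclusion-exclusion. The
  conditional expectation given the observed partition is constant on each of its atoms, hence is
  there the elementary conditional mean.\<close>

section \<open>Generalized Stirling numbers\<close>

text \<open>The exponential generating function of the weights of a single block: (1 - (1 -
  x)^alpha) / alpha for nonzero alpha and -log(1 - x) for alpha = 0. The coefficient at
  \<open>i = 0\<close> is set by hand, since truncated subtraction would give 1 there while blocks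
  are nonempty.\<close>

definition block_egf :: "real \<Rightarrow> real fps" where
  "block_egf \<alpha> = Abs_fps (\<lambda>i. if i = 0 then 0 else pochhammer (1 - \<alpha>) (i - 1) / fact i)"

lemma compositions_Suc:
  "compositions n (Suc k) = (\<lambda>(i, ns). i # ns) ` (SIGMA i:{1..n}. compositions (n - i) k)"
proof (intro equalityI subsetI)
  fix xs assume xs: "xs \<in> compositions n (Suc k)"
  then obtain i ns where "xs = i # ns" by (cases xs) (auto simp: compositions_def)
  with xs show "xs \<in> (\<lambda>(i, ns). i # ns) ` (SIGMA i:{1..n}. compositions (n - i) k)"
    by (intro image_eqI[where x="(i, ns)"]) (auto simp: compositions_def)
qed (auto simp: compositions_def)

lemma sum_compositions_Suc:
  "(\<Sum>ns\<in>compositions n (Suc k). f ns) = (\<Sum>i=1..n. \<Sum>ns\<in>compositions (n - i) k. f (i # ns))"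
proof -
  have "inj_on (\<lambda>(i, ns). i # ns) (SIGMA i:{1..n}. compositions (n - i) k)"
    by (auto simp: inj_on_def)
  then show ?thesis
    by (simp add: compositions_Suc sum.reindex sum.Sigma finite_compositions case_prod_unfold)
qed

text \<open>Splitting off the first part of a composition is the Cauchy product with one more factor
  \<open>block_egf \<alpha>\<close>.\<close>

lemma sum_compositions_eq_fps_nth:
  "(\<Sum>ns\<in>compositions n k. \<Prod>i<k. pochhammer (1 - \<alpha>) (ns ! i - 1) / fact (ns ! i)) =
    fps_nth (block_egf \<alpha> ^ k) n"
proof (induction k arbitrary: n)
  case 0
  have "compositions n 0 = (if n = 0 then {[]} else {})" by (auto simp: compositions_def)
  then show ?case by simp
next
  case (Suc k)
  have "(\<Sum>ns\<in>compositions n (Suc k). \<Prod>i<Suc k. pochhammer (1 - \<alpha>) (ns ! i - 1) / fact (ns ! i)) =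
      (\<Sum>i=1..n. pochhammer (1 - \<alpha>) (i - 1) / fact i * fps_nth (block_egf \<alpha> ^ k) (n - i))"
    unfolding sum_compositions_Suc
    by (simp add: prod.lessThan_Suc_shift Suc.IH[symmetric] sum_distrib_left
        del: prod.lessThan_Suc)
  \<comment> \<open>The index 0 may be added because the series has no constant term.\<close>
  also have "\<dots> = (\<Sum>i=0..n. fps_nth (block_egf \<alpha>) i * fps_nth (block_egf \<alpha> ^ k) (n - i))"
    by (rule sum.mono_neutral_cong_left) (auto simp: block_egf_def)
  finally show ?case by (simp add: fps_mult_nth)
qed

lemma central_stirling_eq_fps_nth:
  "central_stirling \<alpha> n k = fact n / fact k * fps_nth (block_egf \<alpha> ^ k) n"
  unfolding central_stirling_def sum_compositions_eq_fps_nth ..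

text \<open>The binomial convolution in the definition is a product of exponential generating
  functions; the second factor is the series of (1 - x)^gamma.\<close>

lemma noncentral_stirling_eq_fps_nth:
  "noncentral_stirling \<alpha> \<gamma> n k = fact n / fact k *
    fps_nth (block_egf \<alpha> ^ k * Abs_fps (\<lambda>i. pochhammer (- \<gamma>) i / fact i)) n"
proof -
  have "noncentral_stirling \<alpha> \<gamma> n k =
      (\<Sum>s=0..n. real (n choose s) * central_stirling \<alpha> s k * pochhammer (- \<gamma>) (n - s))"
    unfolding noncentral_stirling_def
    by (rule sum.mono_neutral_left) (auto simp: central_stirling_gt)
  also have "\<dots> = (\<Sum>s=0..n. fact n / fact k *
      (fps_nth (block_egf \<alpha> ^ k) s * (pochhammer (- \<gamma>) (n - s) / fact (n - s))))"
    by (rule sum.cong) (auto simp: central_stirling_eq_fps_nth binomial_fact mult_ac)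
  finally show ?thesis by (simp add: fps_mult_nth sum_distrib_left)
qed

lemma noncentral_stirling_0: "noncentral_stirling \<alpha> \<gamma> n 0 = pochhammer (- \<gamma>) n"
  by (simp add: noncentral_stirling_eq_fps_nth)

text \<open>Peel one factor \<open>block_egf \<alpha>\<close> off the power; the factor
  \<open>Suc k\<close> turns 1/(k+1)! into 1/k!. Combinatorially, one of the k+1 new blocks is
  distinguished and \<open>b\<close> is its size.\<close>

lemma noncentral_stirling_Suc:
  "real (Suc k) * noncentral_stirling \<alpha> \<gamma> n (Suc k) =
    (\<Sum>b=1..n. real (n choose b) * (pochhammer (1 - \<alpha>) (b - 1) * noncentral_stirling \<alpha> \<gamma> (n - b) k))"
proof -
  let ?H = "block_egf \<alpha> ^ k * Abs_fps (\<lambda>i. pochhammer (- \<gamma>) i / fact i)"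
  have "real (Suc k) * noncentral_stirling \<alpha> \<gamma> n (Suc k) =
      fact n / fact k * fps_nth (block_egf \<alpha> * ?H) n"
    by (simp add: noncentral_stirling_eq_fps_nth mult.assoc del: of_nat_Suc)
  also have "\<dots> = (\<Sum>b=0..n. fact n / fact k * (fps_nth (block_egf \<alpha>) b * fps_nth ?H (n - b)))"
    by (simp add: fps_mult_nth[of "block_egf \<alpha>"] sum_distrib_left)
  also have "\<dots> = (\<Sum>b=1..n. fact n / fact k * (fps_nth (block_egf \<alpha>) b * fps_nth ?H (n - b)))"
    by (rule sum.mono_neutral_right) (auto simp: block_egf_def)
  also have "\<dots> = (\<Sum>b=1..n. real (n choose b) *
      (pochhammer (1 - \<alpha>) (b - 1) * noncentral_stirling \<alpha> \<gamma> (n - b) k))"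
    by (rule sum.cong) (auto simp: noncentral_stirling_eq_fps_nth binomial_fact block_egf_def)
  finally show ?thesis .
qed

text \<open>Turns a sum over the marked block into a sum over its size, the shape of the right-hand
  side of \<open>noncentral_stirling_Suc\<close>.\<close>

lemma sum_Pow_card:
  assumes "finite U"
  shows "(\<Sum>B\<in>Pow U - {{}}. h (card B)) = (\<Sum>b=1..card U. real (card U choose b) * h b)"
proof -
  have "(\<Sum>B\<in>Pow U - {{}}. h (card B)) =
      (\<Sum>b=1..card U. \<Sum>B | B \<in> Pow U - {{}} \<and> card B = b. h (card B))"
    using assms
    by (intro sum.group[symmetric])
      (auto simp: card_gt_0_iff Suc_le_eq card_mono dest: finite_subset)
  also have "\<dots> = (\<Sum>b=1..card U. \<Sum>B | B \<subseteq> U \<and> card B = b. h b)"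
    by (intro sum.cong) auto
  finally show ?thesis using assms by (simp add: n_subsets)
qed

section \<open>Partitions extending a given partition\<close>

text \<open>\<open>U\<close> holds the added elements and is kept an arbitrary set: deleting a block
  from a partition of an interval leaves a ground set that is in general no interval.\<close>

definition extensions :: "'a set \<Rightarrow> 'a set set \<Rightarrow> 'a set \<Rightarrow> 'a set set set" where
  "extensions X A U = {P. partition_on (X \<union> U) P \<and> (\<lambda>B. B \<inter> X) ` P - {{}} = A}"

definition new_blocks :: "'a set \<Rightarrow> 'a set set \<Rightarrow> 'a set set" where
  "new_blocks X P = {B \<in> P. B \<inter> X = {}}"

definition gibbs_weight :: "real \<Rightarrow> 'a set set \<Rightarrow> real" where
  "gibbs_weight \<alpha> P = (\<Prod>B\<in>P. pochhammer (1 - \<alpha>) (card B - 1))"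

lemma finite_extensions: "finite X \<Longrightarrow> finite U \<Longrightarrow> finite (extensions X A U)"
  by (rule finite_subset[of _ "Pow (Pow (X \<union> U))"]) (auto simp: extensions_def partition_on_def)

lemma finite_extension: "P \<in> extensions X A U \<Longrightarrow> finite X \<Longrightarrow> finite U \<Longrightarrow> finite P"
  unfolding extensions_def by (blast intro: finite_elements[OF finite_UnI])

lemma finite_new_blocks: "finite P \<Longrightarrow> finite (new_blocks X P)"
  by (simp add: new_blocks_def)

lemma extensions_empty: "partition_on X A \<Longrightarrow> extensions X A {} = {A}"
proof -
  have "(\<lambda>B. B \<inter> X) ` P - {{}} = P" if "partition_on X P" for P
  proof -
    have "(\<lambda>B. B \<inter> X) ` P = (\<lambda>B. B) ` P"
      using that by (intro image_cong) (auto simp: partition_on_def)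
    then show ?thesis using that by (auto simp: partition_on_def)
  qed
  then show "partition_on X A \<Longrightarrow> extensions X A {} = {A}"
    by (auto simp: extensions_def)
qed

text \<open>Intersecting with \<open>X\<close> maps the old blocks bijectively onto
  \<open>A\<close>: two blocks with the same nonempty trace share a point and so coincide. This is
  the origin of the index j + k of the weights V.\<close>

lemma card_extension:
  assumes P: "P \<in> extensions X A U" and fin: "finite X" "finite U"
  shows "card P = card A + card (new_blocks X P)"
proof -
  let ?O = "{B \<in> P. B \<inter> X \<noteq> {}}"
  have dis: "B = C" if "B \<in> P" "C \<in> P" "x \<in> B" "x \<in> C" for B C x
    using P that unfolding extensions_def partition_on_def disjoint_def by blast
  have "inj_on (\<lambda>B. B \<inter> X) ?O"
  proof (rule inj_onI)
    fix B C assume BC: "B \<in> ?O" "C \<in> ?O" "B \<inter> X = C \<inter> X"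
    then obtain x where "x \<in> B" "x \<in> C" by blast
    with BC show "B = C" by (intro dis) auto
  qed
  moreover have "(\<lambda>B. B \<inter> X) ` ?O = A"
  proof -
    have "A = (\<lambda>B. B \<inter> X) ` P - {{}}" using P by (simp add: extensions_def)
    also have "\<dots> = (\<lambda>B. B \<inter> X) ` ?O" by blast
    finally show ?thesis by simp
  qed
  ultimately have "card A = card ?O" by (metis (no_types, lifting) card_image)
  moreover have "card P = card (?O \<union> new_blocks X P)"
    by (rule arg_cong[where f=card]) (auto simp: new_blocks_def)
  moreover have "\<dots> = card ?O + card (new_blocks X P)"
    using finite_extension[OF P fin] by (intro card_Un_disjoint) (auto simp: new_blocks_def)
  ultimately show ?thesis by simp
qed

section \<open>Deleting and inserting a new block\<close>

lemma new_block_subset: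
  assumes "P \<in> extensions X A U" "B \<in> new_blocks X P"
  shows "B \<subseteq> U \<and> B \<noteq> {}"
proof -
  have "\<Union>P = X \<union> U" "{} \<notin> P" using assms(1) by (simp_all add: extensions_def partition_on_def)
  with assms(2) show ?thesis unfolding new_blocks_def by blast
qed

text \<open>A new block misses \<open>X\<close>, so deleting it changes no nonempty trace; as the
  other blocks are disjoint from it, the ground set loses exactly \<open>B\<close>.\<close>

lemma extensions_remove_block:
  assumes P: "P \<in> extensions X A U" and B: "B \<in> new_blocks X P"
  shows "P - {B} \<in> extensions X A (U - B)"
proof -
  have dis: "disjoint P" "\<Union>P = X \<union> U" "{} \<notin> P" "B \<in> P" "B \<inter> X = {}"
    using P B by (auto simp: extensions_def new_blocks_def partition_on_def)
  have "C \<inter> B = {}" if "C \<in> P - {B}" for C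
    using that dis(1,4) by (auto simp: disjoint_def)
  then have "\<Union>(P - {B}) = \<Union>P - B" by auto
  with dis(2,5) have "\<Union>(P - {B}) = X \<union> (U - B)" by auto
  moreover have "(\<lambda>C. C \<inter> X) ` (P - {B}) - {{}} = (\<lambda>C. C \<inter> X) ` P - {{}}"
    using dis(5) by blast
  moreover have "disjoint (P - {B})" using dis(1) by (auto simp: disjoint_def)
  ultimately show ?thesis
    using P dis(3) by (simp add: extensions_def partition_on_def)
qed

text \<open>The inverse of the deletion. \<open>B\<close> is nonempty and lies outside the ground
  set of \<open>P\<close>, so it is not yet a block and removing it again restores
  \<open>P\<close>.\<close>

lemma extensions_insert_block:
  assumes P: "P \<in> extensions X A (U - B)" and B: "B \<subseteq> U" "B \<noteq> {}" and dis: "X \<inter> U = {}"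
  shows "insert B P \<in> extensions X A U" "B \<in> new_blocks X (insert B P)" "B \<notin> P"
proof -
  have un: "\<Union>P = X \<union> (U - B)" using P by (simp add: extensions_def partition_on_def)
  show "B \<notin> P" using un B dis by blast
  have BX: "B \<inter> X = {}" using B dis by auto
  then show "B \<in> new_blocks X (insert B P)" by (simp add: new_blocks_def)
  have "C \<inter> B = {}" if "C \<in> P" for C using that un B dis by blast
  moreover have "disjoint P" "{} \<notin> P" using P by (simp_all add: extensions_def partition_on_def)
  ultimately have "disjoint (insert B P)" by (auto simp: disjoint_def)
  moreover have "\<Union>(insert B P) = X \<union> U" using un B by auto
  ultimately show "insert B P \<in> extensions X A U"
    using P B BX by (simp add: extensions_def partition_on_def)
qed

text \<open>Double counting: an extension with a marked new block is the same as a nonempty subset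
  of \<open>U\<close> together with an extension over the rest. \<open>F\<close> receives the
  remaining partition, so that the factor of the marked block can be split off.\<close>

lemma sum_mark_new_block:
  assumes fin: "finite X" "finite U" and dis: "X \<inter> U = {}"
  shows "(\<Sum>P\<in>extensions X A U. \<Sum>B\<in>new_blocks X P. F B (P - {B})) =
    (\<Sum>B\<in>Pow U - {{}}. \<Sum>P\<in>extensions X A (U - B). F B P)"
proof -
  have "(\<Sum>(P, B)\<in>(SIGMA P:extensions X A U. new_blocks X P). F B (P - {B})) =
      (\<Sum>(B, P)\<in>(SIGMA B:Pow U - {{}}. extensions X A (U - B)). F B P)"
  proof (rule sum.reindex_bij_witness[where i="\<lambda>(B, P). (insert B P, B)" and j="\<lambda>(P, B). (B, P - {B})"])
    fix x assume "x \<in> (SIGMA P:extensions X A U. new_blocks X P)"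
    then obtain P B where x: "x = (P, B)" "P \<in> extensions X A U" "B \<in> new_blocks X P" by blast
    then show "(case case x of (P, B) \<Rightarrow> (B, P - {B}) of (B, P) \<Rightarrow> (insert B P, B)) = x"
      by (auto simp: new_blocks_def)
    show "(case x of (P, B) \<Rightarrow> (B, P - {B})) \<in> (SIGMA B:Pow U - {{}}. extensions X A (U - B))"
      using x new_block_subset[OF x(2,3)] extensions_remove_block[OF x(2,3)] by simp
    show "(case case x of (P, B) \<Rightarrow> (B, P - {B}) of (B, P) \<Rightarrow> F B P) = (case x of (P, B) \<Rightarrow> F B (P - {B}))"
      by (simp add: x)
  next
    fix y assume "y \<in> (SIGMA B:Pow U - {{}}. extensions X A (U - B))"
    then obtain B P where y: "y = (B, P)" "B \<subseteq> U" "B \<noteq> {}" "P \<in> extensions X A (U - B)" by blast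
    note ins = extensions_insert_block[OF y(4,2,3) dis]
    show "(case case y of (B, P) \<Rightarrow> (insert B P, B) of (P, B) \<Rightarrow> (B, P - {B})) = y"
      using ins(3) y(1) by simp
    show "(case y of (B, P) \<Rightarrow> (insert B P, B)) \<in> (SIGMA P:extensions X A U. new_blocks X P)"
      using ins y(1) by simp
  qed
  then show ?thesis
    using fin by (subst (1 2) sum.Sigma)
      (auto intro: finite_extensions finite_new_blocks finite_extension)
qed

section \<open>Extensions without new blocks, built one element at a time\<close>

lemma gibbs_weight_remove:
  "finite P \<Longrightarrow> B \<in> P \<Longrightarrow>
    gibbs_weight \<alpha> P = pochhammer (1 - \<alpha>) (card B - 1) * gibbs_weight \<alpha> (P - {B})"
  unfolding gibbs_weight_def by (rule prod.remove)

text \<open>Enlarging a block of size c appends the factor c - alpha to its Pochhammer symbol and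
  leaves the other blocks alone.\<close>

lemma gibbs_weight_grow:
  assumes "finite P" "B \<in> P" "finite B" "B \<noteq> {}" "u \<notin> B" "insert u B \<notin> P"
  shows "gibbs_weight \<alpha> (insert (insert u B) (P - {B})) = (real (card B) - \<alpha>) * gibbs_weight \<alpha> P"
proof -
  obtain c where c: "card B = Suc c"
    using assms by (metis card_gt_0_iff gr0_implies_Suc)
  have "gibbs_weight \<alpha> (insert (insert u B) (P - {B})) =
      pochhammer (1 - \<alpha>) (card B) * gibbs_weight \<alpha> (P - {B})"
    using assms by (simp add: gibbs_weight_def)
  also have "\<dots> = (real (card B) - \<alpha>) * gibbs_weight \<alpha> P"
    using assms by (simp add: gibbs_weight_remove[of P B] c pochhammer_Suc algebra_simps)
  finally show ?thesis .
qed

text \<open>The total of the growth factors of \<open>gibbs_weight_grow\<close> over all blocks.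
  Block sizes add up to the size of the ground set and the number of blocks is
  \<open>card A\<close>, so the total is the same for all such \<open>P\<close>.\<close>

lemma sum_card_minus_extension:
  assumes P: "P \<in> extensions X A U" and fin: "finite X" "finite U" and dis: "X \<inter> U = {}"
    and new: "new_blocks X P = {}"
  shows "(\<Sum>B\<in>P. real (card B) - \<alpha>) = real (card X) - real (card A) * \<alpha> + real (card U)"
proof -
  have part: "partition_on (X \<union> U) P" using P by (simp add: extensions_def)
  have "finite B" if "B \<in> P" for B
    using that partition_onD1[OF part] fin by (auto intro: finite_subset[of B "X \<union> U"])
  then have "(\<Sum>B\<in>P. card B) = card (X \<union> U)"
    using product_partition[OF part] by simp
  also have "\<dots> = card X + card U" using fin dis by (simp add: card_Un_disjoint)
  finally have "real (\<Sum>B\<in>P. card B) = real (card X + card U)" by simp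
  moreover have "card P = card A" using card_extension[OF P fin] new by simp
  ultimately show ?thesis by (simp add: sum_subtractf)
qed

lemma extensions_grow_block:
  assumes P: "P \<in> extensions X A U" "new_blocks X P = {}" and B: "B \<in> P" and u: "u \<notin> X \<union> U"
  shows "insert (insert u B) (P - {B}) \<in> extensions X A (insert u U)"
    and "new_blocks X (insert (insert u B) (P - {B})) = {}"
proof -
  let ?Q = "insert (insert u B) (P - {B})"
  have part: "disjoint P" "\<Union>P = X \<union> U" "{} \<notin> P"
    using P by (auto simp: extensions_def partition_on_def)
  have "u \<notin> C" if "C \<in> P" for C using that part(2) u by blast
  then have "disjoint ?Q" using part(1) B by (auto simp: disjoint_def)
  moreover have "\<Union>?Q = insert u (\<Union>P)" using B by auto
  ultimately have "partition_on (X \<union> insert u U) ?Q" using part by (simp add: partition_on_def)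
  moreover have "(\<lambda>C. C \<inter> X) ` ?Q = (\<lambda>C. C \<inter> X) ` insert B (P - {B})"
    using u by auto
  then have "(\<lambda>C. C \<inter> X) ` ?Q = (\<lambda>C. C \<inter> X) ` P"
    using B by (simp only: insert_Diff)
  ultimately show "?Q \<in> extensions X A (insert u U)" using P by (simp add: extensions_def)
  show "new_blocks X ?Q = {}" using P(2) B by (auto simp: new_blocks_def)
qed

text \<open>The inverse of growing. Since there are no new blocks, \<open>C\<close> meets
  \<open>X\<close>, and it still does without \<open>u\<close>; hence the shrunken block is
  nonempty, remains old and differs from the other blocks.\<close>

lemma extensions_shrink_block:
  assumes P: "P \<in> extensions X A (insert u U)" "new_blocks X P = {}"
    and C: "C \<in> P" "u \<in> C" and u: "u \<notin> X \<union> U"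
  shows "insert (C - {u}) (P - {C}) \<in> extensions X A U"
    and "new_blocks X (insert (C - {u}) (P - {C})) = {}"
    and "C - {u} \<notin> P - {C}"
proof -
  let ?Q = "insert (C - {u}) (P - {C})"
  have part: "disjoint P" "\<Union>P = X \<union> insert u U" "{} \<notin> P"
    using P by (auto simp: extensions_def partition_on_def)
  have "C \<inter> X \<noteq> {}" using P(2) C by (auto simp: new_blocks_def)
  then have CX: "(C - {u}) \<inter> X \<noteq> {}" using u by blast
  have dis: "D \<inter> C = {}" if "D \<in> P - {C}" for D
    using part(1) that C by (auto simp: disjoint_def)
  show notin: "C - {u} \<notin> P - {C}"
  proof
    assume "C - {u} \<in> P - {C}"
    from dis[OF this] CX show False by blast
  qed
  have "disjoint ?Q" using part(1) dis by (auto simp: disjoint_def)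
  moreover have "u \<notin> D" if "D \<in> P - {C}" for D using dis[OF that] C(2) by blast
  then have "\<Union>?Q = \<Union>P - {u}" using C by auto
  then have "\<Union>?Q = X \<union> U" using u part(2) by auto
  ultimately have "partition_on (X \<union> U) ?Q" using part(3) CX by (auto simp: partition_on_def)
  moreover have "(C - {u}) \<inter> X = C \<inter> X" using u by auto
  then have "(\<lambda>D. D \<inter> X) ` ?Q = (\<lambda>D. D \<inter> X) ` insert C (P - {C})"
    by (simp only: image_insert)
  then have "(\<lambda>D. D \<inter> X) ` ?Q = (\<lambda>D. D \<inter> X) ` P" using C by (simp only: insert_Diff)
  ultimately show "?Q \<in> extensions X A U" using P by (simp add: extensions_def)
  show "new_blocks X ?Q = {}" using P(2) CX by (auto simp: new_blocks_def)
qed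

text \<open>Without new blocks \<open>u\<close> cannot be a singleton, so an extension over
  \<open>insert u U\<close> arises from exactly one extension over \<open>U\<close> and one choice
  of the block that \<open>u\<close> joins.\<close>

lemma sum_extensions_insert_no_new:
  assumes u: "u \<notin> X \<union> U" and fin: "finite X" "finite U"
  shows "(\<Sum>P | P \<in> extensions X A (insert u U) \<and> new_blocks X P = {}. f P) =
    (\<Sum>P | P \<in> extensions X A U \<and> new_blocks X P = {}.
      \<Sum>B\<in>P. f (insert (insert u B) (P - {B})))"
proof -
  let ?E = "\<lambda>U. {P. P \<in> extensions X A U \<and> new_blocks X P = {}}"
  let ?g = "\<lambda>(P, B). insert (insert u B) (P - {B})"
  have notin: "u \<notin> C" if "P \<in> ?E U" "C \<in> P" for P C
    using that u by (auto simp: extensions_def dest!: partition_onD1)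
  have "inj_on ?g (SIGMA P:?E U. P)"
  proof (rule inj_onI)
    fix x y assume "x \<in> (SIGMA P:?E U. P)" "y \<in> (SIGMA P:?E U. P)" and eq: "?g x = ?g y"
    then obtain P B P' B' where xy: "x = (P, B)" "y = (P', B')"
      and PB: "P \<in> ?E U" "B \<in> P" "P' \<in> ?E U" "B' \<in> P'" by blast
    have eq: "insert (insert u B) (P - {B}) = insert (insert u B') (P' - {B'})"
      using eq xy by simp
    \<comment> \<open>Only the grown block contains \<open>u\<close>; it can therefore be read off
      from the image, and with it \<open>B\<close> and then \<open>P\<close>.\<close>
    have u1: "u \<notin> C" if "C \<in> P - {B}" for C using that notin PB by blast
    have u2: "u \<notin> C" if "C \<in> P' - {B'}" for C using that notin PB by blast
    have i: "insert u B \<notin> P - {B}" "insert u B' \<notin> P' - {B'}"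
      using u1[of "insert u B"] u2[of "insert u B'"] by auto
    have "insert u B \<in> insert (insert u B') (P' - {B'})" using eq by blast
    with u2[of "insert u B"] have B: "insert u B = insert u B'" by blast
    with notin[OF PB(1,2)] notin[OF PB(3,4)] have "B = B'" by (simp add: insert_ident)
    moreover have "P - {B} = P' - {B'}"
    proof (rule iffD1[OF insert_ident])
      show "insert u B \<notin> P - {B}" "insert u B \<notin> P' - {B'}" using i B by simp_all
      show "insert (insert u B) (P - {B}) = insert (insert u B) (P' - {B'})" using eq B by simp
    qed
    ultimately show "x = y" using PB xy by (metis insert_Diff)
  qed
  moreover have "?g ` (SIGMA P:?E U. P) = ?E (insert u U)"
  proof (intro equalityI subsetI)
    fix Q assume "Q \<in> ?g ` (SIGMA P:?E U. P)"
    then obtain P B where "P \<in> ?E U" "B \<in> P" "Q = insert (insert u B) (P - {B})" by blast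
    then show "Q \<in> ?E (insert u U)" using extensions_grow_block[of P X A U B u] u by simp
  next
    fix Q assume Q: "Q \<in> ?E (insert u U)"
    then have "u \<in> \<Union>Q" by (auto simp: extensions_def dest!: partition_onD1)
    then obtain C where C: "C \<in> Q" "u \<in> C" by blast
    note shrink = extensions_shrink_block[of Q X A u U C]
    have "Q = ?g (insert (C - {u}) (Q - {C}), C - {u})"
      using C Q u shrink(3) by (simp add: insert_absorb insert_Diff)
    moreover have "(insert (C - {u}) (Q - {C}), C - {u}) \<in> (SIGMA P:?E U. P)"
      using C Q u shrink by simp
    ultimately show "Q \<in> ?g ` (SIGMA P:?E U. P)" by (rule image_eqI)
  qed
  ultimately have "sum f (?E (insert u U)) = (\<Sum>(P, B)\<in>(SIGMA P:?E U. P). f (?g (P, B)))"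
    by (subst sum.reindex_bij_betw[of ?g, symmetric]) (auto simp: bij_betw_def case_prod_unfold)
  then show ?thesis
    using fin by (subst sum.Sigma) (auto simp: finite_extensions intro: finite_extension)
qed

text \<open>The total growth factor is the same for all extensions, so it leaves the sum and becomes
  the next factor of the Pochhammer symbol.\<close>

lemma sum_gibbs_weight_no_new:
  assumes A: "partition_on X A" and fin: "finite X" "finite U" and dis: "X \<inter> U = {}"
  shows "(\<Sum>P | P \<in> extensions X A U \<and> new_blocks X P = {}. gibbs_weight \<alpha> P) =
    gibbs_weight \<alpha> A * pochhammer (real (card X) - real (card A) * \<alpha>) (card U)"
  using fin(2) dis
proof (induction U rule: finite_induct)
  case empty
  have "B \<inter> X = B \<and> B \<noteq> {}" if "B \<in> A" for B using that A by (auto simp: partition_on_def)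
  then have "{P. P \<in> extensions X A {} \<and> new_blocks X P = {}} = {A}"
    unfolding extensions_empty[OF A] by (auto simp: new_blocks_def)
  then show ?case by simp
next
  case (insert u U)
  let ?E = "{P. P \<in> extensions X A U \<and> new_blocks X P = {}}"
  let ?x = "real (card X) - real (card A) * \<alpha>"
  have "(\<Sum>B\<in>P. gibbs_weight \<alpha> (insert (insert u B) (P - {B}))) =
      (?x + real (card U)) * gibbs_weight \<alpha> P" if P: "P \<in> ?E" for P
  proof -
    have part: "partition_on (X \<union> U) P" using P by (simp add: extensions_def)
    have "gibbs_weight \<alpha> (insert (insert u B) (P - {B})) = (real (card B) - \<alpha>) * gibbs_weight \<alpha> P"
      if B: "B \<in> P" for B
    proof (rule gibbs_weight_grow)
      have sub: "C \<subseteq> X \<union> U" if "C \<in> P" for C using that partition_onD1[OF part] by blast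
      show "finite P" using P fin insert by (auto intro: finite_extension)
      show "finite B" using sub[OF B] fin(1) insert.hyps(1) by (auto intro: finite_subset)
      show "B \<noteq> {}" using part B by (auto simp: partition_on_def)
      show "u \<notin> B" "insert u B \<notin> P" using sub B insert by blast+
    qed (rule B)
    then have "(\<Sum>B\<in>P. gibbs_weight \<alpha> (insert (insert u B) (P - {B}))) =
        (\<Sum>B\<in>P. real (card B) - \<alpha>) * gibbs_weight \<alpha> P"
      by (simp add: sum_distrib_right)
    then show ?thesis
      using sum_card_minus_extension[of P X A U \<alpha>] P fin insert by simp
  qed
  then have "(\<Sum>P | P \<in> extensions X A (insert u U) \<and> new_blocks X P = {}. gibbs_weight \<alpha> P) =
      (?x + real (card U)) * (\<Sum>P\<in>?E. gibbs_weight \<alpha> P)"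
    using insert.hyps insert.prems fin
    by (subst sum_extensions_insert_no_new) (simp_all add: sum_distrib_left)
  also have "\<dots> = (?x + real (card U)) * (gibbs_weight \<alpha> A * pochhammer ?x (card U))"
    using insert.IH insert.prems by simp
  finally show ?case using insert by (simp add: pochhammer_Suc mult_ac)
qed

section \<open>Binomial moments of the number of new blocks\<close>

lemma new_blocks_Diff: "B \<in> new_blocks X P \<Longrightarrow> new_blocks X (P - {B}) = new_blocks X P - {B}"
  by (auto simp: new_blocks_def)

lemma sum_card_new_blocks_le:
  assumes P: "P \<in> extensions X A U" and fin: "finite X" "finite U"
  shows "(\<Sum>B\<in>new_blocks X P. card B) \<le> card U"
proof -
  have "disjoint (new_blocks X P)"
    using P by (auto simp: extensions_def new_blocks_def partition_on_def disjoint_def)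
  moreover have "finite B" if "B \<in> new_blocks X P" for B
    using new_block_subset[OF P that] fin(2) by (auto intro: finite_subset)
  ultimately have "(\<Sum>B\<in>new_blocks X P. card B) = card (\<Union>(new_blocks X P))"
    by (simp add: card_Union_disjoint)
  also have "\<dots> \<le> card U"
    using new_block_subset[OF P] fin(2) by (intro card_mono) auto
  finally show ?thesis .
qed

lemma card_new_blocks_le:
  assumes P: "P \<in> extensions X A U" and fin: "finite X" "finite U"
  shows "card (new_blocks X P) \<le> card U"
proof -
  have "1 \<le> card B" if "B \<in> new_blocks X P" for B
    using new_block_subset[OF P that] finite_subset[OF _ fin(2)] by (simp add: Suc_le_eq card_gt_0_iff)
  then have "(\<Sum>B\<in>new_blocks X P. 1) \<le> (\<Sum>B\<in>new_blocks X P. card B)" by (rule sum_mono)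
  with sum_card_new_blocks_le[OF assms] show ?thesis by simp
qed

text \<open>The marking recursion is matched with \<open>noncentral_stirling_Suc\<close>. The
  induction runs over all \<open>U\<close>, as marking \<open>B\<close> replaces \<open>U\<close> by
  \<open>U - B\<close>. The parameter carries a minus sign because the Stirling numbers involve the
  rising factorial of -gamma.\<close>

lemma sum_gibbs_weight_card_new:
  assumes A: "partition_on X A" and fin: "finite X" "finite U" and dis: "X \<inter> U = {}"
  shows "(\<Sum>P\<in>extensions X A U. of_bool (card (new_blocks X P) = k) * gibbs_weight \<alpha> P) =
    gibbs_weight \<alpha> A * noncentral_stirling \<alpha> (- (real (card X) - real (card A) * \<alpha>)) (card U) k"
  using fin(2) dis
proof (induction k arbitrary: U)
  case 0
  have "(\<Sum>P\<in>extensions X A U. of_bool (card (new_blocks X P) = 0) * gibbs_weight \<alpha> P) =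
      (\<Sum>P | P \<in> extensions X A U \<and> new_blocks X P = {}. gibbs_weight \<alpha> P)"
    using fin(1) 0
    by (intro sum.mono_neutral_cong_right)
      (auto simp: finite_extensions finite_new_blocks dest: finite_extension)
  then show ?case
    using sum_gibbs_weight_no_new[OF A fin(1) 0, of \<alpha>] by (simp add: noncentral_stirling_0)
next
  case (Suc k)
  let ?S = "noncentral_stirling \<alpha> (- (real (card X) - real (card A) * \<alpha>))"
  let ?w = "\<lambda>P. of_bool (card (new_blocks X P) = k) * gibbs_weight \<alpha> P"
  let ?F = "\<lambda>B P. pochhammer (1 - \<alpha>) (card B - 1) * ?w P"
  \<comment> \<open>Restoring the factor of the deleted block gives back the whole weight, so every
    new block contributes the same value; if their number is not \<open>Suc k\<close>, both sides
    vanish.\<close>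
  have mark: "real (Suc k) * (of_bool (card (new_blocks X P) = Suc k) * gibbs_weight \<alpha> P) =
      (\<Sum>B\<in>new_blocks X P. ?F B (P - {B}))" if P: "P \<in> extensions X A U" for P
  proof -
    have finP: "finite P" "finite (new_blocks X P)"
      using finite_extension[OF P fin(1) Suc.prems(1)] by (simp_all add: finite_new_blocks)
    have "?F B (P - {B}) = of_bool (card (new_blocks X P) = Suc k) * gibbs_weight \<alpha> P"
      if B: "B \<in> new_blocks X P" for B
    proof -
      have "B \<in> P" using B by (simp add: new_blocks_def)
      note weight = gibbs_weight_remove[OF finP(1) this, of \<alpha>]
      have "card (new_blocks X P) = Suc (card (new_blocks X (P - {B})))"
        unfolding new_blocks_Diff[OF B] by (rule card.remove[OF finP(2) B])
      then show ?thesis unfolding weight by (simp only: nat.inject mult.left_commute)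
    qed
    then show ?thesis by simp
  qed
  have "real (Suc k) * (\<Sum>P\<in>extensions X A U. of_bool (card (new_blocks X P) = Suc k) * gibbs_weight \<alpha> P) =
      (\<Sum>P\<in>extensions X A U. \<Sum>B\<in>new_blocks X P. ?F B (P - {B}))"
    unfolding sum_distrib_left by (intro sum.cong refl mark)
  also have "\<dots> = (\<Sum>B\<in>Pow U - {{}}. \<Sum>P\<in>extensions X A (U - B). ?F B P)"
    by (rule sum_mark_new_block) (use fin Suc.prems in auto)
  also have "\<dots> = (\<Sum>B\<in>Pow U - {{}}. pochhammer (1 - \<alpha>) (card B - 1) *
      (gibbs_weight \<alpha> A * ?S (card U - card B) k))"
  proof (rule sum.cong[OF refl])
    fix B assume B: "B \<in> Pow U - {{}}"
    then have "card (U - B) = card U - card B"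
      using Suc.prems by (intro card_Diff_subset) (auto intro: finite_subset)
    then show "(\<Sum>P\<in>extensions X A (U - B). ?F B P) =
        pochhammer (1 - \<alpha>) (card B - 1) * (gibbs_weight \<alpha> A * ?S (card U - card B) k)"
      using Suc.IH[of "U - B"] Suc.prems by (auto simp: sum_distrib_left[symmetric])
  qed
  also have "\<dots> = gibbs_weight \<alpha> A * (\<Sum>b=1..card U. real (card U choose b) *
      (pochhammer (1 - \<alpha>) (b - 1) * ?S (card U - b) k))"
    by (subst sum_Pow_card[OF Suc.prems(1)]) (simp add: sum_distrib_left mult_ac)
  also have "\<dots> = real (Suc k) * (gibbs_weight \<alpha> A * ?S (card U) (Suc k))"
    by (simp only: noncentral_stirling_Suc[symmetric] mult_ac)
  finally show ?case by (simp del: of_nat_Suc)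
qed

text \<open>\<open>g\<close> is a placeholder for V at level n + m, which sees only the number of
  blocks. The sum stops at \<open>card U\<close> because every new block uses up an element of
  \<open>U\<close>.\<close>

lemma sum_gibbs_weight_by_card:
  assumes A: "partition_on X A" and fin: "finite X" "finite U" and dis: "X \<inter> U = {}"
  shows "(\<Sum>P\<in>extensions X A U. g (card P) * gibbs_weight \<alpha> P) =
    gibbs_weight \<alpha> A * (\<Sum>k=0..card U. g (card A + k) *
      noncentral_stirling \<alpha> (- (real (card X) - real (card A) * \<alpha>)) (card U) k)"
proof -
  have "(\<Sum>P\<in>extensions X A U. g (card P) * gibbs_weight \<alpha> P) =
      (\<Sum>P\<in>extensions X A U. \<Sum>k=0..card U.
        g (card A + k) * (of_bool (card (new_blocks X P) = k) * gibbs_weight \<alpha> P))"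
  proof (rule sum.cong[OF refl])
    fix P assume P: "P \<in> extensions X A U"
    have "(\<Sum>k=0..card U. g (card A + k) * (of_bool (card (new_blocks X P) = k) * gibbs_weight \<alpha> P)) =
        (\<Sum>k=0..card U. if k = card (new_blocks X P) then g (card A + k) * gibbs_weight \<alpha> P else 0)"
      by (intro sum.cong) auto
    then show "g (card P) * gibbs_weight \<alpha> P =
        (\<Sum>k=0..card U. g (card A + k) * (of_bool (card (new_blocks X P) = k) * gibbs_weight \<alpha> P))"
      using card_new_blocks_le[OF P fin] card_extension[OF P fin] by simp
  qed
  also have "\<dots> = (\<Sum>k=0..card U. g (card A + k) *
      (\<Sum>P\<in>extensions X A U. of_bool (card (new_blocks X P) = k) * gibbs_weight \<alpha> P))"
    by (subst sum.swap) (simp add: sum_distrib_left)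
  finally show ?thesis
    unfolding sum_gibbs_weight_card_new[OF assms] by (simp add: sum_distrib_left mult_ac)
qed

section \<open>Moments for blocks of a fixed size\<close>

definition new_blocks_of_size :: "'a set \<Rightarrow> nat \<Rightarrow> 'a set set \<Rightarrow> 'a set set" where
  "new_blocks_of_size X l P = {B \<in> P. B \<inter> X = {} \<and> card B = l}"

lemma sum_of_bool_new_blocks_of_size:
  assumes "finite P"
  shows "(\<Sum>B\<in>new_blocks X P. of_bool (card B = l)) = real (card (new_blocks_of_size X l P))"
  using assms by (simp add: sum.If_cases of_bool_def finite_new_blocks)
   (auto simp: new_blocks_def new_blocks_of_size_def intro!: arg_cong[where f=card])

text \<open>Disjoint blocks of size \<open>l\<close> have to fit into \<open>U\<close>. This bound
  is the cutoff of the later alternating sum.\<close>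

lemma card_new_blocks_of_size_le:
  assumes P: "P \<in> extensions X A U" and fin: "finite X" "finite U" and l: "1 \<le> l"
  shows "card (new_blocks_of_size X l P) \<le> card U div l"
proof -
  have "card (new_blocks_of_size X l P) * l = (\<Sum>B\<in>new_blocks_of_size X l P. card B)"
    by (simp add: new_blocks_of_size_def)
  also have "\<dots> \<le> (\<Sum>B\<in>new_blocks X P. card B)"
    using finite_extension[OF P fin]
    by (intro sum_mono2) (auto simp: new_blocks_def new_blocks_of_size_def)
  also have "\<dots> \<le> card U" using sum_card_new_blocks_le[OF P fin] .
  finally show ?thesis using l by (simp add: less_eq_div_iff_mult_less_eq)
qed

text \<open>The moment counts choices of \<open>r\<close> new blocks of size \<open>l\<close>: the
  factorials count the ways of placing these blocks in \<open>U\<close>, each contributes its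
  weight, and the last sum is the total weight over the remaining elements. If the blocks do not
  fit, the moment is 0.\<close>

lemma binomial_moment_new_blocks:
  fixes g :: "nat \<Rightarrow> real"
  assumes A: "partition_on X A" and fin: "finite X" "finite U" and dis: "X \<inter> U = {}" and l: "1 \<le> l"
  shows "(\<Sum>P\<in>extensions X A U. real (card (new_blocks_of_size X l P) choose r) *
      (g (card P) * gibbs_weight \<alpha> P)) =
    (if r * l \<le> card U then
      gibbs_weight \<alpha> A * (pochhammer (1 - \<alpha>) (l - 1) ^ r / (fact r * fact l ^ r)) *
      (fact (card U) / fact (card U - r * l)) *
      (\<Sum>k=0..card U - r * l. g (card A + r + k) *
        noncentral_stirling \<alpha> (- (real (card X) - real (card A) * \<alpha>)) (card U - r * l) k)
     else 0)"
  using fin(2) dis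
proof (induction r arbitrary: U g)
  case 0
  then show ?case using sum_gibbs_weight_by_card[OF A fin(1), of U g \<alpha>] by simp
next
  case (Suc r)
  let ?S = "noncentral_stirling \<alpha> (- (real (card X) - real (card A) * \<alpha>))"
  let ?w = "pochhammer (1 - \<alpha>) (l - 1)"
  let ?N = "\<lambda>P. card (new_blocks_of_size X l P)"
  let ?G = "\<lambda>P. real (?N P choose r) * (g (Suc (card P)) * gibbs_weight \<alpha> P)"
  \<comment> \<open>The indicator lets only blocks of size \<open>l\<close> be marked.\<close>
  let ?F = "\<lambda>B P. of_bool (card B = l) * (?w * ?G P)"
  let ?R = "\<lambda>u. if r * l \<le> u then
      gibbs_weight \<alpha> A * (?w ^ r / (fact r * fact l ^ r)) * (fact u / fact (u - r * l)) *
      (\<Sum>k=0..u - r * l. g (Suc (card A + r + k)) * ?S (u - r * l) k) else 0"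
  have mark: "real (Suc r) * (real (?N P choose Suc r) * (g (card P) * gibbs_weight \<alpha> P)) =
      (\<Sum>B\<in>new_blocks X P. ?F B (P - {B}))" if P: "P \<in> extensions X A U" for P
  proof -
    have finP: "finite P" using finite_extension[OF P fin(1) Suc.prems(1)] .
    have "?F B (P - {B}) = of_bool (card B = l) *
        (real (?N P - 1 choose r) * (g (card P) * gibbs_weight \<alpha> P))"
      if B: "B \<in> new_blocks X P" for B
    proof (cases "card B = l")
      case True
      have BP: "B \<in> P" using B by (simp add: new_blocks_def)
      have "new_blocks_of_size X l (P - {B}) = new_blocks_of_size X l P - {B}"
        "B \<in> new_blocks_of_size X l P"
        using B True by (auto simp: new_blocks_of_size_def new_blocks_def)
      then have "?N (P - {B}) = ?N P - 1" by simp
      moreover have "Suc (card (P - {B})) = card P" using card.remove[OF finP BP] by (rule sym)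
      ultimately show ?thesis
        using gibbs_weight_remove[OF finP BP, of \<alpha>] True by simp
    qed simp
    then have "(\<Sum>B\<in>new_blocks X P. ?F B (P - {B})) = (\<Sum>B\<in>new_blocks X P. of_bool (card B = l) *
        (real (?N P - 1 choose r) * (g (card P) * gibbs_weight \<alpha> P)))"
      by (intro sum.cong refl)
    also have "\<dots> = real (?N P) * (real (?N P - 1 choose r) * (g (card P) * gibbs_weight \<alpha> P))"
      using sum_of_bool_new_blocks_of_size[OF finP, where X=X and l=l]
      by (simp only: sum_distrib_right[symmetric])
    finally have "(\<Sum>B\<in>new_blocks X P. ?F B (P - {B})) =
        real (?N P) * (real (?N P - 1 choose r) * (g (card P) * gibbs_weight \<alpha> P))" .
    \<comment> \<open>Absorption accounts for the choice of the marked block among the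
      \<open>r + 1\<close> chosen ones.\<close>
    moreover have "real (Suc r) * real (?N P choose Suc r) = real (?N P) * real (?N P - 1 choose r)"
      unfolding of_nat_mult[symmetric] by (simp only: binomial_absorption)
    ultimately show ?thesis by (simp only: mult.assoc[symmetric])
  qed
  have "real (Suc r) * (\<Sum>P\<in>extensions X A U. real (?N P choose Suc r) * (g (card P) * gibbs_weight \<alpha> P)) =
      (\<Sum>P\<in>extensions X A U. \<Sum>B\<in>new_blocks X P. ?F B (P - {B}))"
    unfolding sum_distrib_left by (intro sum.cong refl mark)
  also have "\<dots> = (\<Sum>B\<in>Pow U - {{}}. \<Sum>P\<in>extensions X A (U - B). ?F B P)"
    by (rule sum_mark_new_block) (use fin Suc.prems in auto)
  also have "\<dots> = (\<Sum>B\<in>Pow U - {{}}. of_bool (card B = l) * (?w * ?R (card U - card B)))"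
  proof (rule sum.cong[OF refl])
    fix B assume B: "B \<in> Pow U - {{}}"
    then have c: "card (U - B) = card U - card B"
      using Suc.prems by (intro card_Diff_subset) (auto intro: finite_subset)
    have "(\<Sum>P\<in>extensions X A (U - B). ?G P) = ?R (card U - card B)"
    proof -
      have "finite (U - B)" "X \<inter> (U - B) = {}" using Suc.prems by auto
      \<comment> \<open>Deleting the marked block lowers the number of blocks by one, so the
        induction hypothesis is applied to the shifted \<open>g\<close>.\<close>
      from Suc.IH[OF this, of "\<lambda>k. g (Suc k)"] show ?thesis unfolding c by simp
    qed
    then show "(\<Sum>P\<in>extensions X A (U - B). ?F B P) =
        of_bool (card B = l) * (?w * ?R (card U - card B))"
      by (simp add: sum_distrib_left[symmetric])
  qed
  also have "\<dots> = (\<Sum>b=1..card U. real (card U choose b) * (of_bool (b = l) * (?w * ?R (card U - b))))"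
    by (rule sum_Pow_card[OF Suc.prems(1)])
  also have "\<dots> = (\<Sum>b=1..card U. if b = l then real (card U choose l) * (?w * ?R (card U - l)) else 0)"
    by (intro sum.cong) auto
  also have "\<dots> = (if l \<le> card U then real (card U choose l) * (?w * ?R (card U - l)) else 0)"
    using l by simp
  \<comment> \<open>There is room for \<open>r + 1\<close> blocks exactly when one fits and
    \<open>r\<close> fit into the rest; otherwise both sides are 0.\<close>
  also have "\<dots> = real (Suc r) * (if Suc r * l \<le> card U then
      gibbs_weight \<alpha> A * (?w ^ Suc r / (fact (Suc r) * fact l ^ Suc r)) *
      (fact (card U) / fact (card U - Suc r * l)) *
      (\<Sum>k=0..card U - Suc r * l. g (card A + Suc r + k) * ?S (card U - Suc r * l) k) else 0)"
  proof (cases "Suc r * l \<le> card U")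
    case True
    then have le: "l \<le> card U" "r * l \<le> card U - l" by auto
    have "card U - l - r * l = card U - Suc r * l" by simp
    moreover have "real (card U choose l) * fact (card U - l) = fact (card U) / fact l"
      using le by (simp add: binomial_fact)
    moreover have "real (Suc r) / fact (Suc r) = 1 / fact r" by (simp add: fact_Suc del: of_nat_Suc)
    ultimately show ?thesis using le True
      by (simp add: binomial_fact field_simps del: of_nat_Suc)
  qed auto
  finally show ?case by (simp only: mult_cancel_left of_nat_eq_0_iff) simp
qed

text \<open>Inversion of binomial moments: C(N, x+r) C(x+r, x) = C(N, x) C(N-x, r), and the
  alternating sum of the C(N-x, r) vanishes unless N = x.\<close>

lemma of_bool_eq_alternating_binomial_sum:
  assumes "N \<le> x + R"
  shows "of_bool (N = x) = (\<Sum>r=0..R. (-1) ^ r * real ((x + r) choose x) * real (N choose (x + r)))"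
proof (cases "N < x")
  case False
  then obtain d where N: "N = x + d" by (metis le_Suc_ex not_less)
  have "(\<Sum>r=0..R. (-1) ^ r * real ((x + r) choose x) * real (N choose (x + r))) =
      (\<Sum>r=0..R. real (N choose x) * ((-1) ^ r * real (d choose r)))"
  proof (rule sum.cong[OF refl])
    fix r
    show "(-1) ^ r * real ((x + r) choose x) * real (N choose (x + r)) =
        real (N choose x) * ((-1) ^ r * real (d choose r))"
    proof (cases "r \<le> d")
      case True
      then have "(N choose (x + r)) * ((x + r) choose x) = (N choose x) * (d choose r)"
        using choose_mult[of x "x + r" N] N by simp
      then have "real (N choose (x + r)) * real ((x + r) choose x) = real (N choose x) * real (d choose r)"
        by (metis of_nat_mult)
      then show ?thesis by (simp add: mult_ac)
    qed (simp add: N binomial_eq_0)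
  qed
  also have "\<dots> = real (N choose x) * (\<Sum>r=0..R. (-1) ^ r * real (d choose r))"
    by (simp add: sum_distrib_left)
  \<comment> \<open>The hypothesis on \<open>R\<close> gives d <= R, and the binomial coefficients
    beyond \<open>d\<close> vanish.\<close>
  also have "(\<Sum>r=0..R. (-1) ^ r * real (d choose r)) = (\<Sum>r\<le>d. (-1) ^ r * real (d choose r))"
    using assms N by (intro sum.mono_neutral_right) auto
  also have "\<dots> = of_bool (d = 0)"
    using choose_alternating_sum[of d, where ?'a=real] by (cases "d = 0") auto
  finally show ?thesis by (cases "d = 0") (simp_all add: N)
qed (simp add: binomial_eq_0)

section \<open>Conditioning on an observed partition\<close>

text \<open>The chosen version is measurable for the sigma-algebra of all preimages under
  \<open>Z\<close>, hence constant on each fibre, and its integral over the fibre fixes the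
  constant. The equation therefore holds at every point of \<open>E\<close>, not just almost
  everywhere.\<close>

lemma (in prob_space) real_cond_exp_vimage_atom:
  assumes Z: "Z \<in> M \<rightarrow>\<^sub>M count_space UNIV" and X: "integrable M X"
    and E: "E = {\<omega> \<in> space M. Z \<omega> = a}" "prob E > 0" and \<omega>: "\<omega> \<in> E"
  shows "real_cond_exp M (vimage_algebra (space M) Z (count_space UNIV)) X \<omega> =
    (\<integral>x. indicator E x * X x \<partial>M) / prob E"
proof -
  let ?F = "vimage_algebra (space M) Z (count_space UNIV)"
  let ?Y = "real_cond_exp M ?F X"
  have sets_F: "sets ?F = {Z -` B \<inter> space M | B. B \<in> UNIV}"
    by (subst sets_vimage_algebra2) auto
  have "subalgebra M ?F"
    unfolding subalgebra_def sets_F using measurable_sets[OF Z] by auto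
  then interpret finite_measure_subalgebra M ?F
    by unfold_locales
  have EF: "E \<in> sets ?F" unfolding sets_F E(1) by (auto intro!: exI[of _ "{a}"])
  then have EM: "E \<in> sets M" using \<open>subalgebra M ?F\<close> by (auto simp: subalgebra_def)
  have "?Y -` {?Y \<omega>} \<inter> space ?F \<in> sets ?F"
    by (rule measurable_sets[OF borel_measurable_cond_exp]) simp
  then obtain B where B: "?Y -` {?Y \<omega>} \<inter> space M = Z -` B \<inter> space M"
    unfolding sets_F by auto
  \<comment> \<open>The level set of \<open>?Y\<close> through \<open>\<omega>\<close> is a preimage
    under \<open>Z\<close>, so it contains the whole fibre \<open>E\<close>.\<close>
  have const: "?Y x = ?Y \<omega>" if "x \<in> E" for x
  proof -
    have "\<omega> \<in> Z -` B \<inter> space M" using \<omega> E(1) by (simp add: B[symmetric])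
    then have "x \<in> Z -` B \<inter> space M" using that \<omega> E(1) by auto
    then show ?thesis by (simp add: B[symmetric])
  qed
  have "(\<integral>x. indicator E x * X x \<partial>M) = (\<integral>x. indicator E x * ?Y x \<partial>M)"
    using real_cond_exp_intA[OF X EF] by (simp add: set_lebesgue_integral_def)
  also have "\<dots> = (\<integral>x. indicator E x * ?Y \<omega> \<partial>M)"
    by (intro Bochner_Integration.integral_cong refl) (auto simp: indicator_def const)
  also have "\<dots> = prob E * ?Y \<omega>" using EM by simp
  finally show ?thesis using E(2) by simp
qed

lemma (in prob_space) integral_uniform_measure:
  fixes f :: "'a \<Rightarrow> real"
  assumes E: "E \<in> sets M" "prob E > 0" and f: "f \<in> borel_measurable M"
  shows "(\<integral>x. f x \<partial>uniform_measure M E) = (\<integral>x. indicator E x * f x \<partial>M) / prob E"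
proof -
  \<comment> \<open>Since \<open>E\<close> has positive probability, the extended nonnegative
    density is that of a real function, for which the integral formula for real densities
    applies.\<close>
  have "uniform_measure M E = density M (\<lambda>x. ennreal (indicator E x / prob E))"
    unfolding uniform_measure_def
    by (intro arg_cong[where f="density M"] ext)
      (use E(2) in \<open>auto simp: emeasure_eq_measure indicator_def divide_ennreal[symmetric]\<close>)
  then have "(\<integral>x. f x \<partial>uniform_measure M E) = (\<integral>x. indicator E x / prob E * f x \<partial>M)"
    using E f by (simp add: integral_real_density)
  then show ?thesis by simp
qed

section \<open>Restrictions of the random partition\<close>

lemma partition_on_restr_part: "partition_on {1..} Q \<Longrightarrow> partition_on {1..N} (restr_part N Q)"
proof -
  assume "partition_on {1..} Q"
  from partition_on_restrict[OF this, of "{1..N}"]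
  have "partition_on {1..N} ((\<inter>) {1..N} ` Q - {{}})" by (simp add: Int_absorb2 Icc_subset_Ici_iff)
  moreover have "(\<inter>) {1..N} = (\<lambda>B. B \<inter> {1..N})" by auto
  ultimately show ?thesis by (simp add: restr_part_def)
qed

lemma restr_part_restr_part: "restr_part n (restr_part (n + m) Q) = restr_part n Q"
proof -
  have "B \<inter> {1..n + m} \<inter> {1..n} = B \<inter> {1..n}" for B :: "nat set" by auto
  then have "(\<lambda>B. B \<inter> {1..n}) ` (\<lambda>B. B \<inter> {1..n + m}) ` Q = (\<lambda>B. B \<inter> {1..n}) ` Q"
    by (simp add: image_image)
  moreover have "(\<lambda>B. B \<inter> {1..n}) ` (R - {{}}) - {{}} = (\<lambda>B. B \<inter> {1..n}) ` R - {{}}" for R :: "nat set set"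
    by auto
  ultimately show ?thesis by (simp only: restr_part_def)
qed

lemma num_new_blocks_eq:
  "num_new_blocks n m l Q = card (new_blocks_of_size {1..n} l (restr_part (n + m) Q))"
  by (simp add: num_new_blocks_def new_blocks_of_size_def)

abbreviation restr_extensions :: "nat \<Rightarrow> nat \<Rightarrow> nat set set \<Rightarrow> nat set set set" where
  "restr_extensions n m A \<equiv> extensions {1..n} A {n + 1..n + m}"

lemma restr_extensions_iff:
  "P \<in> restr_extensions n m A \<longleftrightarrow> partition_on {1..n + m} P \<and> restr_part n P = A"
proof -
  have "{1..n} \<union> {n + 1..n + m} = {1..n + m}" by auto
  then show ?thesis by (simp add: extensions_def restr_part_def)
qed

context gibbs_partition
begin

lemma restr_event_sets: "{\<omega> \<in> space M. restr_part n (\<pi> \<omega>) = A} \<in> sets M"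
proof -
  have "(\<lambda>\<omega>. restr_part n (\<pi> \<omega>)) -` {A} \<inter> space M \<in> sets M"
    by (rule measurable_sets[OF measurable_restr]) simp
  moreover have "(\<lambda>\<omega>. restr_part n (\<pi> \<omega>)) -` {A} \<inter> space M = {\<omega> \<in> space M. restr_part n (\<pi> \<omega>) = A}"
    by auto
  ultimately show ?thesis by simp
qed

text \<open>The conditioning event splits into the finitely many disjoint events that the
  restriction to {1..n+m} equals a given extension of \<open>A\<close>, and the Gibbs law gives
  their probabilities.\<close>

lemma integral_restr_event:
  fixes f :: "nat set set \<Rightarrow> real"
  assumes n: "1 \<le> n"
  shows "(\<integral>\<omega>. indicator {\<omega> \<in> space M. restr_part n (\<pi> \<omega>) = A} \<omega> * f (restr_part (n + m) (\<pi> \<omega>)) \<partial>M) =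
    (\<Sum>P\<in>restr_extensions n m A. f P * (V (n + m) (card P) * gibbs_weight \<alpha> P))"
proof -
  let ?E = "\<lambda>P. {\<omega> \<in> space M. restr_part (n + m) (\<pi> \<omega>) = P}"
  have "(\<integral>\<omega>. indicator {\<omega> \<in> space M. restr_part n (\<pi> \<omega>) = A} \<omega> * f (restr_part (n + m) (\<pi> \<omega>)) \<partial>M) =
      (\<integral>\<omega>. (\<Sum>P\<in>restr_extensions n m A. f P * indicator (?E P) \<omega>) \<partial>M)"
  proof (intro Bochner_Integration.integral_cong refl)
    fix \<omega> assume \<omega>: "\<omega> \<in> space M"
    let ?P = "restr_part (n + m) (\<pi> \<omega>)"
    have "?P \<in> restr_extensions n m A \<longleftrightarrow> restr_part n (\<pi> \<omega>) = A"
      using partition_on_restr_part[OF partition_\<pi>[OF \<omega>]]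
      unfolding restr_extensions_iff restr_part_restr_part by simp
    moreover have "(\<Sum>P\<in>restr_extensions n m A. f P * indicator (?E P) \<omega>) =
        (\<Sum>P\<in>restr_extensions n m A. if P = ?P then f P else 0)"
      using \<omega> by (intro sum.cong) (auto simp: indicator_def)
    ultimately show "indicator {\<omega> \<in> space M. restr_part n (\<pi> \<omega>) = A} \<omega> * f ?P =
        (\<Sum>P\<in>restr_extensions n m A. f P * indicator (?E P) \<omega>)"
      using \<omega> by (simp add: finite_extensions indicator_def)
  qed
  also have "\<dots> = (\<Sum>P\<in>restr_extensions n m A. f P * prob (?E P))"
    using restr_event_sets by (subst Bochner_Integration.integral_sum) (auto simp: emeasure_eq_measure)
  also have "\<dots> = (\<Sum>P\<in>restr_extensions n m A. f P * (V (n + m) (card P) * gibbs_weight \<alpha> P))"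
  proof (rule sum.cong[OF refl])
    fix P assume "P \<in> restr_extensions n m A"
    then have "partition_on {1..n + m} P" unfolding restr_extensions_iff by simp
    then show "f P * prob (?E P) = f P * (V (n + m) (card P) * gibbs_weight \<alpha> P)"
      using law[of "n + m" P] n by (simp add: gibbs_weight_def)
  qed
  finally show ?thesis .
qed

lemma prob_restr_event:
  "1 \<le> n \<Longrightarrow> partition_on {1..n} A \<Longrightarrow>
    prob {\<omega> \<in> space M. restr_part n (\<pi> \<omega>) = A} = V n (card A) * gibbs_weight \<alpha> A"
  by (simp add: law gibbs_weight_def)

lemma gibbs_weight_pos: "gibbs_weight \<alpha> A > 0"
  unfolding gibbs_weight_def using alpha_less_1 by (intro prod_pos) (auto intro: pochhammer_pos)

text \<open>A function of the restriction is bounded, since a finite set has only finitely many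
  partitions.\<close>

lemma integrable_restr_part:
  fixes f :: "nat set set \<Rightarrow> real"
  shows "(\<lambda>\<omega>. f (restr_part N (\<pi> \<omega>))) \<in> borel_measurable M"
    and "integrable M (\<lambda>\<omega>. f (restr_part N (\<pi> \<omega>)))"
proof -
  show meas: "(\<lambda>\<omega>. f (restr_part N (\<pi> \<omega>))) \<in> borel_measurable M"
    by (rule measurable_compose[OF measurable_restr]) simp
  have "finite {P. partition_on {1..N} P}" by (rule finitely_many_partition_on) simp
  then have "norm (f (restr_part N (\<pi> \<omega>))) \<le> Max ((\<lambda>P. norm (f P)) ` {P. partition_on {1..N} P})"
    if "\<omega> \<in> space M" for \<omega>
    using partition_on_restr_part[OF partition_\<pi>[OF that]] by (intro Max_ge) auto
  then show "integrable M (\<lambda>\<omega>. f (restr_part N (\<pi> \<omega>)))"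
    using meas by (intro integrable_const_bound AE_I2)
qed

end

section \<open>Conditional distribution and mean of the number of new blocks of a given size\<close>

context gibbs_partition
begin

text \<open>The inner sum is reindexed to start at \<open>i\<close>, so that the summation variable
  counts all new blocks, the \<open>i\<close> chosen ones included.\<close>

lemma binomial_moment_num_new_blocks:
  assumes n: "1 \<le> n" and A: "partition_on {1..n} A" and l: "1 \<le> l" and i: "i * l \<le> m"
  shows "(\<Sum>P\<in>restr_extensions n m A. real (card (new_blocks_of_size {1..n} l P) choose i) *
      (V (n + m) (card P) * gibbs_weight \<alpha> P)) =
    gibbs_weight \<alpha> A * (pochhammer (1 - \<alpha>) (l - 1) ^ i / (fact i * fact l ^ i)) *
      (fact m / fact (m - i * l)) *
      (\<Sum>k=i..i+(m - i * l). V (n + m) (card A + k) *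
        noncentral_stirling \<alpha> (- (real n - real (card A) * \<alpha>)) (m - i * l) (k - i))"
proof -
  have "{1..n} \<inter> {n + 1..n + m} = {}" by auto
  moreover have "card {n + 1..n + m} = m" by simp
  moreover have "(\<Sum>k=i..i+(m - i * l). V (n + m) (card A + k) *
        noncentral_stirling \<alpha> (- (real n - real (card A) * \<alpha>)) (m - i * l) (k - i)) =
      (\<Sum>k=0..m - i * l. V (n + m) (card A + i + k) *
        noncentral_stirling \<alpha> (- (real n - real (card A) * \<alpha>)) (m - i * l) k)"
    using sum.shift_bounds_cl_nat_ivl[of "\<lambda>k. V (n + m) (card A + k) *
        noncentral_stirling \<alpha> (- (real n - real (card A) * \<alpha>)) (m - i * l) (k - i)" 0 i "m - i * l"]
    by (simp add: ac_simps)
  ultimately show ?thesis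
    using binomial_moment_new_blocks[of "{1..n}" A "{n + 1..n + m}" l i "V (n + m)" \<alpha>] A l i
    by simp
qed

text \<open>The term \<open>r\<close> of the inclusion-exclusion uses the moment of order
  \<open>x + r\<close>. The weight of \<open>A\<close> appears in numerator and denominator and
  cancels, leaving only V in the denominator.\<close>

lemma cond_prob_num_new_blocks:
  assumes n: "1 \<le> n" and A: "partition_on {1..n} A" and V: "V n (card A) > 0"
    and l: "1 \<le> l" and x: "x \<le> m div l"
  shows "\<P>(\<omega> in M. num_new_blocks n m l (\<pi> \<omega>) = x \<bar> restr_part n (\<pi> \<omega>) = A) =
    pochhammer (1 - \<alpha>) (l - 1) ^ x / (fact x * fact l ^ x) * (fact m / V n (card A)) *
    (\<Sum>r=0..m div l - x.
       (-1) ^ r * pochhammer (1 - \<alpha>) (l - 1) ^ r / (fact r * fact l ^ r * fact (m - r * l - x * l)) *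
       (\<Sum>k=r+x..r+x+(m - r * l - x * l). V (n + m) (card A + k) *
         noncentral_stirling \<alpha> (- (real n - real (card A) * \<alpha>)) (m - r * l - x * l) (k - r - x)))"
proof -
  let ?E = "{\<omega> \<in> space M. restr_part n (\<pi> \<omega>) = A}"
  let ?N = "\<lambda>P. card (new_blocks_of_size {1..n} l P)"
  let ?v = "\<lambda>P. V (n + m) (card P) * gibbs_weight \<alpha> P"
  let ?w = "pochhammer (1 - \<alpha>) (l - 1)"
  let ?T = "\<lambda>r. \<Sum>k=r+x..r+x+(m - r * l - x * l). V (n + m) (card A + k) *
    noncentral_stirling \<alpha> (- (real n - real (card A) * \<alpha>)) (m - r * l - x * l) (k - r - x)"
  have N_le: "?N P \<le> x + (m div l - x)" if "P \<in> restr_extensions n m A" for P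
    using card_new_blocks_of_size_le[OF that] l x by simp
  let ?Ex = "{\<omega> \<in> space M. num_new_blocks n m l (\<pi> \<omega>) = x \<and> restr_part n (\<pi> \<omega>) = A}"
  have "(\<lambda>\<omega>. indicator ?E \<omega> * of_bool (?N (restr_part (n + m) (\<pi> \<omega>)) = x) :: real) = indicator ?Ex"
    by (auto simp: fun_eq_iff indicator_def num_new_blocks_eq)
  moreover have "?Ex \<inter> space M = ?Ex" by auto
  ultimately have "prob ?Ex = (\<integral>\<omega>. indicator ?E \<omega> * of_bool (?N (restr_part (n + m) (\<pi> \<omega>)) = x) \<partial>M)"
    by (simp only: Bochner_Integration.integral_indicator)
  also have "\<dots> = (\<Sum>P\<in>restr_extensions n m A. of_bool (?N P = x) * ?v P)"
    by (rule integral_restr_event[OF n, of A "\<lambda>P. of_bool (?N P = x)"])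
  also have "\<dots> = (\<Sum>P\<in>restr_extensions n m A. \<Sum>r=0..m div l - x.
      (-1) ^ r * real ((x + r) choose x) * (real (?N P choose (x + r)) * ?v P))"
    by (intro sum.cong refl, subst of_bool_eq_alternating_binomial_sum[OF N_le])
      (simp_all add: sum_distrib_left sum_distrib_right mult_ac)
  also have "\<dots> = (\<Sum>r=0..m div l - x. (-1) ^ r * real ((x + r) choose x) *
      (\<Sum>P\<in>restr_extensions n m A. real (?N P choose (x + r)) * ?v P))"
    by (subst sum.swap) (simp add: sum_distrib_left)
  also have "\<dots> = (\<Sum>r=0..m div l - x. gibbs_weight \<alpha> A * (?w ^ x / (fact x * fact l ^ x) * fact m *
      ((-1) ^ r * ?w ^ r / (fact r * fact l ^ r * fact (m - r * l - x * l)) * ?T r)))"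
  proof (rule sum.cong[OF refl])
    fix r assume "r \<in> {0..m div l - x}"
    then have "x + r \<le> m div l" using x by simp
    then have le: "(x + r) * l \<le> m" using l by (simp add: less_eq_div_iff_mult_less_eq)
    have sub: "m - (x + r) * l = m - r * l - x * l" by (simp add: algebra_simps)
    have "k - (x + r) = k - r - x" for k by simp
    then have moment: "(\<Sum>P\<in>restr_extensions n m A. real (?N P choose (x + r)) * ?v P) =
        gibbs_weight \<alpha> A * (?w ^ (x + r) / (fact (x + r) * fact l ^ (x + r))) *
        (fact m / fact (m - r * l - x * l)) * ?T r"
      using binomial_moment_num_new_blocks[OF n A l le] unfolding sub by (simp add: add.commute)
    \<comment> \<open>The binomial coefficient splits the factorial of \<open>x + r\<close> in the
      moment into two factorials, so that the part in \<open>x\<close> leaves the sum over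
      \<open>r\<close>.\<close>
    have "real ((x + r) choose x) / fact (x + r) = 1 / (fact x * fact r)"
      by (simp add: binomial_fact)
    then have "real ((x + r) choose x) = fact (x + r) / (fact x * fact r)"
      by (simp add: field_simps)
    then show "(-1) ^ r * real ((x + r) choose x) *
        (\<Sum>P\<in>restr_extensions n m A. real (?N P choose (x + r)) * ?v P) =
        gibbs_weight \<alpha> A * (?w ^ x / (fact x * fact l ^ x) * fact m *
        ((-1) ^ r * ?w ^ r / (fact r * fact l ^ r * fact (m - r * l - x * l)) * ?T r))"
      unfolding moment by (simp add: power_add mult_ac)
  qed
  also have "\<dots> = gibbs_weight \<alpha> A * (?w ^ x / (fact x * fact l ^ x) * fact m *
      (\<Sum>r=0..m div l - x. (-1) ^ r * ?w ^ r / (fact r * fact l ^ r * fact (m - r * l - x * l)) * ?T r))"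
    by (simp only: sum_distrib_left)
  finally show ?thesis
    unfolding cond_prob_def using V gibbs_weight_pos[of A] prob_restr_event[OF n A] by simp
qed

text \<open>The mean is the binomial moment of order 1. The unnormalized form suits both the uniform
  measure on the event and the conditional expectation.\<close>

lemma integral_num_new_blocks:
  assumes n: "1 \<le> n" and A: "partition_on {1..n} A" and V: "V n (card A) > 0"
    and l: "1 \<le> l" "l \<le> m"
  defines "E \<equiv> {\<omega> \<in> space M. restr_part n (\<pi> \<omega>) = A}"
  shows "(\<integral>\<omega>. indicator E \<omega> * real (num_new_blocks n m l (\<pi> \<omega>)) \<partial>M) / prob E =
    real (m choose l) * pochhammer (1 - \<alpha>) (l - 1) / V n (card A) *
      (\<Sum>k=1..1+(m - l). V (n + m) (card A + k) *
        noncentral_stirling \<alpha> (- (real n - real (card A) * \<alpha>)) (m - l) (k - 1))"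
proof -
  define T where "T = (\<Sum>k=1..1+(m - l). V (n + m) (card A + k) *
    noncentral_stirling \<alpha> (- (real n - real (card A) * \<alpha>)) (m - l) (k - 1))"
  have "(\<integral>\<omega>. indicator E \<omega> * real (num_new_blocks n m l (\<pi> \<omega>)) \<partial>M) =
      (\<Sum>P\<in>restr_extensions n m A. real (card (new_blocks_of_size {1..n} l P)) *
        (V (n + m) (card P) * gibbs_weight \<alpha> P))"
    unfolding E_def num_new_blocks_eq
    by (rule integral_restr_event[OF n, of A "\<lambda>P. real (card (new_blocks_of_size {1..n} l P))"])
  also have "\<dots> = gibbs_weight \<alpha> A * (pochhammer (1 - \<alpha>) (l - 1) / fact l) * (fact m / fact (m - l)) * T"
    using binomial_moment_num_new_blocks[OF n A l(1), of 1 m] l(2) unfolding T_def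
    by (simp only: mult_1 power_one_right fact_1 choose_one)
  also have "\<dots> = gibbs_weight \<alpha> A * (real (m choose l) * pochhammer (1 - \<alpha>) (l - 1) * T)"
    using l(2) by (simp add: binomial_fact)
  finally show ?thesis
    using prob_restr_event[OF n A] gibbs_weight_pos[of A] V unfolding E_def T_def[symmetric] by simp
qed

end

theorem proposition8:
  fixes M :: "'w measure" and \<pi> :: "'w \<Rightarrow> nat set set"
    and \<alpha> :: real and V :: "nat \<Rightarrow> nat \<Rightarrow> real"
    and n m j :: nat and A :: "nat set set"
  assumes gibbs: "gibbs_partition M \<pi> \<alpha> V"
    and n: "1 \<le> n" and m: "1 \<le> m"
    and A: "partition_on {1..n} A" and j: "card A = j"
    and V_pos: "V n j > 0"
  defines "W \<equiv> \<lambda>l \<omega>. num_new_blocks n m l (\<pi> \<omega>)"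
    and "M_A \<equiv> uniform_measure M {\<omega> \<in> space M. restr_part n (\<pi> \<omega>) = A}"
    and "S \<equiv> noncentral_stirling \<alpha> (- (real n - real j * \<alpha>))"
  shows
    "(\<forall>l\<in>{1..m}. \<forall>x\<in>{0..m div l}.
        \<P>(\<omega> in M. W l \<omega> = x \<bar> restr_part n (\<pi> \<omega>) = A) =
          pochhammer (1 - \<alpha>) (l - 1) ^ x / (fact x * fact l ^ x) * (fact m / V n j) *
          (\<Sum>r=0..m div l - x.
             (-1) ^ r * pochhammer (1 - \<alpha>) (l - 1) ^ r /
               (fact r * fact l ^ r * fact (m - r * l - x * l)) *
             (\<Sum>k=r+x..r+x+(m - r * l - x * l).
                V (n + m) (j + k) * S (m - r * l - x * l) (k - r - x)))) \<and>
     (\<forall>l\<in>{1..m}.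
        let e = real (m choose l) * pochhammer (1 - \<alpha>) (l - 1) / V n j *
                  (\<Sum>k=1..1+(m - l). V (n + m) (j + k) * S (m - l) (k - 1))
        in (\<integral>\<omega>. real (W l \<omega>) \<partial>M_A) = e \<and>
           (AE \<omega> in M. restr_part n (\<pi> \<omega>) = A \<longrightarrow>
              bayes_estimator M \<pi> n (\<lambda>\<omega>'. real (W l \<omega>')) \<omega> = e)) \<and>
     (\<forall>x\<in>{0..m}.
        \<P>(\<omega> in M. W 1 \<omega> = x \<bar> restr_part n (\<pi> \<omega>) = A) =
          fact m / fact x * (1 / V n j) *
          (\<Sum>r=0..m - x.
             (-1) ^ r / (fact r * fact (m - r - x)) *
             (\<Sum>k=r+x..r+x+(m - r - x).
                V (n + m) (j + k) * S (m - r - x) (k - r - x)))) \<and>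
     (\<integral>\<omega>. real (W 1 \<omega>) \<partial>M_A) =
        real m / V n j * (\<Sum>k=1..1+(m - 1). V (n + m) (j + k) * S (m - 1) (k - 1))"
proof -
  interpret gibbs_partition M \<pi> \<alpha> V by (rule gibbs)
  let ?E = "{\<omega> \<in> space M. restr_part n (\<pi> \<omega>) = A}"
  let ?e = "\<lambda>l. real (m choose l) * pochhammer (1 - \<alpha>) (l - 1) / V n j *
    (\<Sum>k=1..1+(m - l). V (n + m) (j + k) * S (m - l) (k - 1))"
  have V: "V n (card A) > 0" using V_pos j by simp
  have posE: "prob ?E > 0" using prob_restr_event[OF n A] mult_pos_pos[OF V gibbs_weight_pos] by simp
  have W: "(\<lambda>\<omega>. real (W l \<omega>)) \<in> borel_measurable M" "integrable M (\<lambda>\<omega>. real (W l \<omega>))" for l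
    unfolding W_def num_new_blocks_eq
    using integrable_restr_part[of "\<lambda>P. real (card (new_blocks_of_size {1..n} l P))" "n + m"] by auto
  have mean: "(\<integral>\<omega>. indicator ?E \<omega> * real (W l \<omega>) \<partial>M) / prob ?E = ?e l" if "l \<in> {1..m}" for l
    using integral_num_new_blocks[OF n A V, of l m] that unfolding W_def S_def j by simp
  have dist: "\<P>(\<omega> in M. W l \<omega> = x \<bar> restr_part n (\<pi> \<omega>) = A) =
      pochhammer (1 - \<alpha>) (l - 1) ^ x / (fact x * fact l ^ x) * (fact m / V n j) *
      (\<Sum>r=0..m div l - x.
         (-1) ^ r * pochhammer (1 - \<alpha>) (l - 1) ^ r /
           (fact r * fact l ^ r * fact (m - r * l - x * l)) *
         (\<Sum>k=r+x..r+x+(m - r * l - x * l).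
            V (n + m) (j + k) * S (m - r * l - x * l) (k - r - x)))"
    if "l \<in> {1..m}" "x \<in> {0..m div l}" for l x
    using cond_prob_num_new_blocks[OF n A V, of l x m] that unfolding W_def S_def j by simp
  have E_mean: "(\<integral>\<omega>. real (W l \<omega>) \<partial>M_A) = ?e l" if "l \<in> {1..m}" for l
    using integral_uniform_measure[OF restr_event_sets posE W(1)] mean[OF that]
    unfolding M_A_def by simp
  have bayes: "AE \<omega> in M. restr_part n (\<pi> \<omega>) = A \<longrightarrow>
      bayes_estimator M \<pi> n (\<lambda>\<omega>'. real (W l \<omega>')) \<omega> = ?e l" if "l \<in> {1..m}" for l
    using real_cond_exp_vimage_atom[OF measurable_restr W(2) refl posE] mean[OF that]
    unfolding bayes_estimator_def by (intro AE_I2) simp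
  \<comment> \<open>For singletons the block weight and the factorial of \<open>l\<close> are both 1
    and \<open>m div 1\<close> is \<open>m\<close>, so the general formulas simplify to the stated
    ones.\<close>
  have "1 \<in> {1..m}" using m by simp
  from dist[OF this] E_mean[OF this] have
    "\<forall>x\<in>{0..m}. \<P>(\<omega> in M. W 1 \<omega> = x \<bar> restr_part n (\<pi> \<omega>) = A) =
        fact m / fact x * (1 / V n j) *
        (\<Sum>r=0..m - x. (-1) ^ r / (fact r * fact (m - r - x)) *
           (\<Sum>k=r+x..r+x+(m - r - x). V (n + m) (j + k) * S (m - r - x) (k - r - x)))"
    "(\<integral>\<omega>. real (W 1 \<omega>) \<partial>M_A) =
        real m / V n j * (\<Sum>k=1..1+(m - 1). V (n + m) (j + k) * S (m - 1) (k - 1))"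
    by simp_all
  with dist E_mean bayes show ?thesis unfolding Let_def by blast
qed

end
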